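(* Let $C$ be a height-2 cone with levels $C^2, C^1, C^0$ and embedded complex $C^{\mathbf g}$, and let each level $C^s$ be equipped with a basis. Suppose that there exists $\alpha$ with $1 \ge \alpha > 0$ such that for every $\ell^2_2 \in C^2_2$ there exists $\hat\ell^2_2 \in C^2_2$ with $\partial^2 \ell^2_2 = \partial^2 \hat \ell^2_2$ and $$|\partial^2 \hat\ell^2_2| \ge \alpha\, |g_2 \hat\ell^2_2|. \qquad (\ast)$$ Then $$\min_{\ell_1 \in C_1 :\, [\ell_1] \in H_1(\partial)\setminus 0} |\ell_1| \;\ge\; \alpha \min_{\ell^1_1 \in C^1_1 :\, \llbracket \ell^1_1\rrbracket \in H_1(\partial^{\mathbf g}) \setminus 0} |\ell^1_1|. \qquad (\ast\ast)$$ The condition $(\ast)$ is referred to as $(\partial^2, g_2)$ satisfying the isoperimetric inequality with (isoperimetric) coefficient $\alpha$. In particular, if $C^2 = \bigoplus_a C^{2a}$ is a direct sum of complexes equipped with bases (with $\partial^2 = \bigoplus_a \partial^{2a}$ and the basis of $C^2$ the disjoint union of those of the $C^{2a}$), and if $(\partial^{2a}, g_2)$ satisfies the isoperimetric inequality with coefficient $1\ge\alpha>0$ for all $a$ (that is, for every $a$ and every $\ell \in C^{2a}_2$ there exists $\hat\ell \in C^{2a}_2$ with $\partial^{2a}\ell = \partial^{2a}\hat\ell$ and $|\partial^{2a}\hat\ell| \ge \alpha |g_2\hat\ell|$), then $(\ast\ast)$ holds.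
   Context: Complexes are over $\mathbb{F}_2$. A height-2 cone is a chain complex $C = (C_2\xrightarrow{\partial} C_1 \xrightarrow{\partial} C_0)$ with decompositions $C_i = C^2_i\oplus C^1_i\oplus C^0_i$ such that $\partial$ is lower-triangular, $$\partial = \begin{pmatrix} \partial^2 & & \\ g_2 & \partial^1 & \\ p & g_1 & \partial^0 \end{pmatrix},\qquad \partial^s: C^s_i\to C^s_{i-1},\ g_2 : C^2_i \to C^1_{i-1},\ g_1 : C^1_i \to C^0_{i-1},\ p: C^2_i \to C^0_{i-1}.$$ Then each level $C^s = (C^s_2 \to C^s_1\to C^s_0)$ with differential $\partial^s$ is a chain complex, and the embedded complex is $C^{\mathbf g} = (H_2(\partial^2) \xrightarrow{[g_2]} H_1(\partial^1)\xrightarrow{[g_1]} H_0(\partial^0))$, where $[g_s]$ are the maps induced on homology; its degree-1 homology is $H_1(\partial^{\mathbf g}) = \ker[g_1]/\operatorname{im}[g_2]$. A complex is equipped with a basis if each of its degrees is equipped with a finite ordered basis; $C$ is then equipped with the disjoint union of the bases of its levels. The (Hamming) weight $|\ell|$ of a vector is the number of basis elements occurring in its expansion. $[\ell_1] \in H_1(\partial)\setminus 0$ means that $\ell_1\in\ker\partial$ has nonzero homology class. $\llbracket \ell^1_1\rrbracket \in H_1(\partial^{\mathbf g})\setminus 0$ means that $\ell^1_1 \in \ker\partial^1$, that $[\ell^1_1] \in \ker [g_1]$, and that the class $\llbracket \ell^1_1\rrbracket$ of $[\ell^1_1]$ in $\ker[g_1]/\operatorname{im}[g_2]$ is nonzero.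 A minimum over the empty set is $+\infty$.
   Formalization: The formal theorem also assumes H_1(∂^2) = 0 and H_1(∂^0) = 0; without this the claim fails, e.g. for C^2_1 = F_2 (or C^0_1 = F_2) with all other spaces zero, where the left side is 1 and the right side is +∞. *)

theory Defs
  imports Complex_Main "HOL-Library.Z2" "HOL-Library.Set_Algebras" "HOL-Library.Extended_Real"
begin

(* All spaces are F_2-subspaces of one ambient F_2-vector space 'v (scalars: the two-element
   field bit). This costs no generality: any finite family of F_2-spaces embeds in a common one. *)

definition linear_on ::
  "(bit \<Rightarrow> 'v \<Rightarrow> 'v) \<Rightarrow> 'v::ab_group_add set \<Rightarrow> 'v set \<Rightarrow> ('v \<Rightarrow> 'v) \<Rightarrow> bool" where
  "linear_on scale V W f \<longleftrightarrow> f ` V \<subseteq> W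
     \<and> (\<forall>x\<in>V. \<forall>y\<in>V. f (x + y) = f x + f y)
     \<and> (\<forall>c. \<forall>x\<in>V. f (scale c x) = scale c (f x))"

definition direct_sum ::
  "(bit \<Rightarrow> 'v \<Rightarrow> 'v) \<Rightarrow> 'i set \<Rightarrow> ('i \<Rightarrow> 'v::ab_group_add set) \<Rightarrow> 'v set \<Rightarrow> bool" where
  "direct_sum scale A V W \<longleftrightarrow> (\<forall>a\<in>A. module.subspace scale (V a))
     \<and> module.span scale (\<Union>a\<in>A. V a) = W
     \<and> (\<forall>a\<in>A. V a \<inter> module.span scale (\<Union>b\<in>A - {a}. V b) = {0})"

(* Three-term complexes V 2 --> V 1 --> V 0, as complexes graded by nat: the map d i goes from
   V i to V (i - 1), V i vanishes for i > 2, and d 0 (on V 0) is the zero map. *)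

definition three_term_complex ::
  "(bit \<Rightarrow> 'v \<Rightarrow> 'v) \<Rightarrow> (nat \<Rightarrow> 'v::ab_group_add set) \<Rightarrow> (nat \<Rightarrow> 'v \<Rightarrow> 'v) \<Rightarrow> bool" where
  "three_term_complex scale V d \<longleftrightarrow>
       (\<forall>i. module.subspace scale (V i))
     \<and> (\<forall>i>2. V i = {0})
     \<and> (\<forall>i. linear_on scale (V i) (V (i - 1)) (d i))
     \<and> (\<forall>x\<in>V 0. d 0 x = 0)
     \<and> (\<forall>i. \<forall>x\<in>V i. d (i - 1) (d i x) = 0)"

(* A quotient X / Y is the set of cosets x +o Y; its zero element is Y. *)

definition quot :: "'a::plus set \<Rightarrow> 'a set \<Rightarrow> 'a set set" where
  "quot X Y = (\<lambda>x. x +o Y) ` X"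

definition cycles :: "(nat \<Rightarrow> 'v::ab_group_add set) \<Rightarrow> (nat \<Rightarrow> 'v \<Rightarrow> 'v) \<Rightarrow> nat \<Rightarrow> 'v set" where
  "cycles V d i = {x \<in> V i. d i x = 0}"

definition boundaries :: "(nat \<Rightarrow> 'v::ab_group_add set) \<Rightarrow> (nat \<Rightarrow> 'v \<Rightarrow> 'v) \<Rightarrow> nat \<Rightarrow> 'v set" where
  "boundaries V d i = d (Suc i) ` V (Suc i)"

definition homology ::
  "(nat \<Rightarrow> 'v::ab_group_add set) \<Rightarrow> (nat \<Rightarrow> 'v \<Rightarrow> 'v) \<Rightarrow> nat \<Rightarrow> 'v set set" where
  "homology V d i = quot (cycles V d i) (boundaries V d i)"

definition hclass ::
  "(nat \<Rightarrow> 'v::ab_group_add set) \<Rightarrow> (nat \<Rightarrow> 'v \<Rightarrow> 'v) \<Rightarrow> nat \<Rightarrow> 'v \<Rightarrow> 'v set" where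
  "hclass V d i x = x +o boundaries V d i"

definition essential_cycles ::
  "(nat \<Rightarrow> 'v::ab_group_add set) \<Rightarrow> (nat \<Rightarrow> 'v \<Rightarrow> 'v) \<Rightarrow> nat \<Rightarrow> 'v set" where
  "essential_cycles V d i =
     {x \<in> cycles V d i. hclass V d i x \<in> homology V d i - {boundaries V d i}}"

(* L s i and D s i are the degree-i part and differential of level s; g s i maps L s i to
   L (s - 1) (i - 1) (only s = 1, 2 matter) and p i maps L 2 i to L 0 (i - 1). The last three
   conjuncts are the columns of the lower-triangular matrix of d. *)

definition height2_cone ::
  "(bit \<Rightarrow> 'v \<Rightarrow> 'v) \<Rightarrow> (nat \<Rightarrow> 'v::ab_group_add set) \<Rightarrow> (nat \<Rightarrow> 'v \<Rightarrow> 'v)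
     \<Rightarrow> (nat \<Rightarrow> nat \<Rightarrow> 'v set) \<Rightarrow> (nat \<Rightarrow> nat \<Rightarrow> 'v \<Rightarrow> 'v)
     \<Rightarrow> (nat \<Rightarrow> nat \<Rightarrow> 'v \<Rightarrow> 'v) \<Rightarrow> (nat \<Rightarrow> 'v \<Rightarrow> 'v) \<Rightarrow> bool" where
  "height2_cone scale C d L D g p \<longleftrightarrow>
       three_term_complex scale C d
     \<and> (\<forall>i. direct_sum scale {0, 1, 2} (\<lambda>s. L s i) (C i))
     \<and> (\<forall>s\<in>{0, 1, 2}. \<forall>i. linear_on scale (L s i) (L s (i - 1)) (D s i))
     \<and> (\<forall>s\<in>{1, 2}. \<forall>i. linear_on scale (L s i) (L (s - 1) (i - 1)) (g s i))
     \<and> (\<forall>i. linear_on scale (L 2 i) (L 0 (i - 1)) (p i))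
     \<and> (\<forall>i. \<forall>x\<in>L 2 i. d i x = D 2 i x + g 2 i x + p i x)
     \<and> (\<forall>i. \<forall>x\<in>L 1 i. d i x = D 1 i x + g 1 i x)
     \<and> (\<forall>i. \<forall>x\<in>L 0 i. d i x = D 0 i x)"

(* Without this condition the comparison of distances fails: if L 2 1 (or L 0 1) is F_2 and all
   other spaces vanish, then the cone has a cycle of weight 1 that is not a boundary, while the
   embedded complex is zero, so that its minimum is infinite. *)

definition regular_cone ::
  "(nat \<Rightarrow> nat \<Rightarrow> 'v::ab_group_add set) \<Rightarrow> (nat \<Rightarrow> nat \<Rightarrow> 'v \<Rightarrow> 'v) \<Rightarrow> bool" where
  "regular_cone L D \<longleftrightarrow>
       homology (L 2) (D 2) 1 = {boundaries (L 2) (D 2) 1}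
     \<and> homology (L 0) (D 0) 1 = {boundaries (L 0) (D 0) 1}"

(* The map induced on homology by f, where Y are the boundaries of the target: for a chain map f
   (up to sign) the image of the class of x is the class of f x. *)

definition induced :: "'v::ab_group_add set \<Rightarrow> ('v \<Rightarrow> 'v) \<Rightarrow> 'v set \<Rightarrow> 'v set" where
  "induced Y f X = f ` X + Y"

definition embedded_cycles ::
  "(nat \<Rightarrow> nat \<Rightarrow> 'v::ab_group_add set) \<Rightarrow> (nat \<Rightarrow> nat \<Rightarrow> 'v \<Rightarrow> 'v)
     \<Rightarrow> (nat \<Rightarrow> nat \<Rightarrow> 'v \<Rightarrow> 'v) \<Rightarrow> 'v set set" where
  "embedded_cycles L D g =
     {X \<in> homology (L 1) (D 1) 1.
        induced (boundaries (L 0) (D 0) 0) (g 1 1) X = boundaries (L 0) (D 0) 0}"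

definition embedded_boundaries ::
  "(nat \<Rightarrow> nat \<Rightarrow> 'v::ab_group_add set) \<Rightarrow> (nat \<Rightarrow> nat \<Rightarrow> 'v \<Rightarrow> 'v)
     \<Rightarrow> (nat \<Rightarrow> nat \<Rightarrow> 'v \<Rightarrow> 'v) \<Rightarrow> 'v set set" where
  "embedded_boundaries L D g =
     induced (boundaries (L 1) (D 1) 1) (g 2 2) ` homology (L 2) (D 2) 2"

(* Elements of the embedded homology are cosets of homology classes, added as sets. *)

definition embedded_homology ::
  "(nat \<Rightarrow> nat \<Rightarrow> 'v::ab_group_add set) \<Rightarrow> (nat \<Rightarrow> nat \<Rightarrow> 'v \<Rightarrow> 'v)
     \<Rightarrow> (nat \<Rightarrow> nat \<Rightarrow> 'v \<Rightarrow> 'v) \<Rightarrow> 'v set set set" where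
  "embedded_homology L D g = quot (embedded_cycles L D g) (embedded_boundaries L D g)"

definition embedded_essential ::
  "(nat \<Rightarrow> nat \<Rightarrow> 'v::ab_group_add set) \<Rightarrow> (nat \<Rightarrow> nat \<Rightarrow> 'v \<Rightarrow> 'v)
     \<Rightarrow> (nat \<Rightarrow> nat \<Rightarrow> 'v \<Rightarrow> 'v) \<Rightarrow> 'v set" where
  "embedded_essential L D g =
     {x \<in> cycles (L 1) (D 1) 1.
        hclass (L 1) (D 1) 1 x \<in> embedded_cycles L D g
      \<and> hclass (L 1) (D 1) 1 x +o embedded_boundaries L D g
          \<in> embedded_homology L D g - {embedded_boundaries L D g}}"

definition finite_basis ::
  "(bit \<Rightarrow> 'v \<Rightarrow> 'v) \<Rightarrow> 'v::ab_group_add set \<Rightarrow> 'v set \<Rightarrow> bool" where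
  "finite_basis scale V B \<longleftrightarrow>
     finite B \<and> \<not> module.dependent scale B \<and> module.span scale B = V"

definition weight :: "(bit \<Rightarrow> 'v \<Rightarrow> 'v) \<Rightarrow> 'v::ab_group_add set \<Rightarrow> 'v \<Rightarrow> nat" where
  "weight scale B x = card {b \<in> B. module.representation scale B x b \<noteq> 0}"

(* Over the empty set the minimum is infinite. *)

definition min_weight :: "(bit \<Rightarrow> 'v \<Rightarrow> 'v) \<Rightarrow> 'v::ab_group_add set \<Rightarrow> 'v set \<Rightarrow> ereal" where
  "min_weight scale B S = (INF x\<in>S. ereal (real (weight scale B x)))"

(* f and g are defined on V; the weights of f x and g x are taken in the bases X and Y. *)

definition isoperimetric ::
  "(bit \<Rightarrow> 'v \<Rightarrow> 'v) \<Rightarrow> 'v::ab_group_add set \<Rightarrow> 'v set \<Rightarrow> ('v \<Rightarrow> 'v) \<Rightarrow> 'v set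
     \<Rightarrow> ('v \<Rightarrow> 'v) \<Rightarrow> real \<Rightarrow> bool" where
  "isoperimetric scale V X f Y g \<alpha> \<longleftrightarrow>
     (\<forall>x\<in>V. \<exists>y\<in>V. f x = f y
        \<and> real (weight scale X (f y)) \<ge> \<alpha> * real (weight scale Y (g y)))"

(* (V, d) with bases B is the direct sum of the complexes (W a, d) with bases E a, where d is
   restricted to each summand. *)

definition based_direct_sum ::
  "(bit \<Rightarrow> 'v \<Rightarrow> 'v) \<Rightarrow> (nat \<Rightarrow> 'v::ab_group_add set) \<Rightarrow> (nat \<Rightarrow> 'v \<Rightarrow> 'v) \<Rightarrow> (nat \<Rightarrow> 'v set)
     \<Rightarrow> 'i set \<Rightarrow> ('i \<Rightarrow> nat \<Rightarrow> 'v set) \<Rightarrow> ('i \<Rightarrow> nat \<Rightarrow> 'v set) \<Rightarrow> bool" where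
  "based_direct_sum scale V d B A W E \<longleftrightarrow>
       (\<forall>a\<in>A. three_term_complex scale (W a) d)
     \<and> (\<forall>a\<in>A. \<forall>i. finite_basis scale (W a i) (E a i))
     \<and> (\<forall>i. direct_sum scale A (\<lambda>a. W a i) (V i))
     \<and> (\<forall>i. B i = (\<Union>a\<in>A. E a i))
     \<and> (\<forall>i. \<forall>a\<in>A. \<forall>b\<in>A. a \<noteq> b \<longrightarrow> E a i \<inter> E b i = {})"

end

theory Submission
  imports Defs
begin

text \<open>
  Let \<open>\<ell> = a + b + c\<close> be a cycle with components in levels 2, 1 and 0. As level 2 has no
  homology in degree 1, \<open>a = D y\<close>, and the isoperimetric inequality lets one choose \<open>y\<close> such that
  \<open>\<alpha> |g y| \<le> |a|\<close>. Subtracting the boundary of \<open>y\<close> from \<open>\<ell>\<close> removes \<open>a\<close> and turns \<open>b\<close> into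
  \<open>b - g y\<close>, which has \<open>\<alpha> |b - g y| \<le> |b| + |a| \<le> |\<ell>|\<close> and is a cycle of the embedded complex.
  If it were trivial there, a further boundary would move \<open>\<ell>\<close> into level 0, which has no homology
  in degree 1 either, so \<open>\<ell>\<close> would be a boundary.
\<close>

section \<open>Linear algebra over the two-element field\<close>

locale bit_space = vector_space scale
  for scale :: "bit \<Rightarrow> 'v::ab_group_add \<Rightarrow> 'v"
begin

text \<open>As a simp rule it would turn \<open>representation B x b \<noteq> 0\<close> into an
  equation with 1, a form that facts about supports do not match.\<close>

declare bit_not_zero_iff [simp del]

lemma linear_on_mem: "linear_on scale V W f \<Longrightarrow> x \<in> V \<Longrightarrow> f x \<in> W"
  and linear_on_add: "linear_on scale V W f \<Longrightarrow> x \<in> V \<Longrightarrow> y \<in> V \<Longrightarrow> f (x + y) = f x + f y"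
  and linear_on_scale: "linear_on scale V W f \<Longrightarrow> x \<in> V \<Longrightarrow> f (scale r x) = scale r (f x)"
  by (auto simp: linear_on_def)

lemma linear_on_zero:
  assumes "linear_on scale V W f" "subspace V"
  shows "f 0 = 0"
  using linear_on_scale[OF assms(1) subspace_0[OF assms(2)], of 0] by simp

lemma linear_on_diff:
  assumes "linear_on scale V W f" "subspace V" "x \<in> V" "y \<in> V"
  shows "f (x - y) = f x - f y"
  using linear_on_add[OF assms(1) subspace_diff[OF assms(2-4)] assms(4)] by simp

lemma linear_on_sum:
  assumes "linear_on scale V W f" "subspace V" "\<And>a. a \<in> F \<Longrightarrow> x a \<in> V"
  shows "f (\<Sum>a\<in>F. x a) = (\<Sum>a\<in>F. f (x a))"
  using assms(3)
proof (induction F rule: infinite_finite_induct)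
  case (insert b F)
  have "(\<Sum>a\<in>F. x a) \<in> V"
    using insert.prems by (intro subspace_sum assms(2)) auto
  then show ?case
    using insert linear_on_add[OF assms(1)] by simp
qed (simp_all add: linear_on_zero[OF assms(1,2)])

lemma linear_on_image_subspace:
  assumes "linear_on scale V W f" "subspace V"
  shows "subspace (f ` V)"
proof (rule subspaceI)
  show "0 \<in> f ` V"
    using linear_on_zero[OF assms] subspace_0[OF assms(2)] by force
next
  fix x y assume "x \<in> f ` V" "y \<in> f ` V"
  then show "x + y \<in> f ` V"
    using linear_on_add[OF assms(1)] subspace_add[OF assms(2)] by (metis (no_types, lifting) imageE imageI)
next
  fix r x assume "x \<in> f ` V"
  then show "scale r x \<in> f ` V"
    using linear_on_scale[OF assms(1)] subspace_scale[OF assms(2)] by (metis (no_types, lifting) imageE imageI)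
qed

text \<open>Translates triviality of a homology class, an equation between cosets, into membership
  in the boundaries.\<close>

lemma coset_eq_iff:
  assumes "subspace S"
  shows "x +o S = S \<longleftrightarrow> x \<in> S"
proof
  assume "x +o S = S"
  then show "x \<in> S"
    using subspace_0[OF assms] set_plus_intro2[of 0 S x] by simp
next
  assume x: "x \<in> S"
  have "y \<in> x +o S" if "y \<in> S" for y
    using set_plus_intro2[of "y - x" S x] subspace_diff[OF assms that x] by simp
  then show "x +o S = S"
    using x subspace_add[OF assms] by (auto simp: elt_set_plus_def)
qed

text \<open>The index set may be infinite, so the components come with a finite index set. The
  induction adds one multiple of a vector at a time.\<close>

lemma span_UN_finite_sum:
  assumes "v \<in> span (\<Union>a\<in>A. V a)" "\<And>a. a \<in> A \<Longrightarrow> subspace (V a)"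
  shows "\<exists>F x. finite F \<and> F \<subseteq> A \<and> (\<forall>a\<in>F. x a \<in> V a) \<and> v = (\<Sum>a\<in>F. x a)"
  using assms(1)
proof (induction rule: span_induct_alt)
  case base
  show ?case by (intro exI[of _ "{}"]) simp
next
  case (step r u v)
  then obtain F x where F: "finite F" "F \<subseteq> A" "\<forall>a\<in>F. x a \<in> V a" "v = (\<Sum>a\<in>F. x a)"
    by blast
  obtain b where b: "b \<in> A" "u \<in> V b"
    using step.hyps by blast
  have ru: "scale r u \<in> V b"
    using b assms(2) subspace_scale by blast
  show ?case
  \<comment> \<open>A component already present at \<open>b\<close> absorbs the new vector;
    otherwise \<open>b\<close> joins the index set.\<close>
  proof (cases "b \<in> F")
    case True
    have "(\<Sum>a\<in>F. (x(b := x b + scale r u)) a) = x b + scale r u + (\<Sum>a\<in>F - {b}. x a)"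
      using F(1) True by (simp add: sum.remove[of F b])
    also have "\<dots> = scale r u + v"
      using F(1,4) True by (simp add: sum.remove[of F b] ac_simps)
    finally show ?thesis
      using F ru b assms(2) True
      by (intro exI[of _ F] exI[of _ "x(b := x b + scale r u)"]) (auto intro: subspace_add)
  next
    case False
    have "(\<Sum>a\<in>insert b F. (x(b := scale r u)) a) = scale r u + (\<Sum>a\<in>F. (x(b := scale r u)) a)"
      using F(1) False by simp
    also have "(\<Sum>a\<in>F. (x(b := scale r u)) a) = v"
      unfolding F(4) using False by (intro sum.cong) auto
    finally show ?thesis
      using F ru b False
      by (intro exI[of _ "insert b F"] exI[of _ "x(b := scale r u)"]) auto
  qed
qed

lemma direct_sum_subset: "direct_sum scale A V W \<Longrightarrow> a \<in> A \<Longrightarrow> V a \<subseteq> W"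
  using span_superset by (fastforce simp: direct_sum_def)

text \<open>A vanishing sum puts \<open>x a\<close> into the span of the other summands, which meets
  \<open>V a\<close> only in 0.\<close>

lemma direct_sum_zero_component:
  assumes "direct_sum scale A V W" "finite A" "\<And>b. b \<in> A \<Longrightarrow> x b \<in> V b"
    "(\<Sum>b\<in>A. x b) = 0" "a \<in> A"
  shows "x a = 0"
proof -
  let ?S = "span (\<Union>b\<in>A - {a}. V b)"
  have "(\<Sum>b\<in>A - {a}. x b) \<in> ?S"
    using assms(3) by (intro span_sum span_base) auto
  moreover have "x a = - (\<Sum>b\<in>A - {a}. x b)"
    using assms by (simp add: sum.remove[of A a] eq_neg_iff_add_eq_0)
  ultimately have "x a \<in> ?S"
    by (simp add: span_neg)
  then have "x a \<in> V a \<inter> ?S"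
    using assms(3,5) by simp
  then show ?thesis
    using assms(1,5) by (auto simp: direct_sum_def)
qed

text \<open>If \<open>v\<close> in \<open>E a\<close> depended on the other basis vectors, the
  contribution \<open>y\<close> of the other summands would be a difference of vectors of
  \<open>V a\<close>, hence 0, and \<open>v\<close> would depend on the rest of \<open>E a\<close>
  alone.\<close>

lemma direct_sum_bases_independent:
  assumes "direct_sum scale A V W"
    and "\<And>a. a \<in> A \<Longrightarrow> independent (E a)" "\<And>a. a \<in> A \<Longrightarrow> span (E a) = V a"
  shows "independent (\<Union>a\<in>A. E a)"
  unfolding dependent_def
proof (safe)
  fix a v assume a: "a \<in> A" "v \<in> E a" and v: "v \<in> span ((\<Union>a\<in>A. E a) - {v})"
  have "(\<Union>a\<in>A. E a) - {v} \<subseteq> (E a - {v}) \<union> (\<Union>b\<in>A - {a}. E b)" by auto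
  then obtain x y where xy: "x \<in> span (E a - {v})" "y \<in> span (\<Union>b\<in>A - {a}. E b)" "v = x + y"
    using v span_mono unfolding span_Un[symmetric] by (smt (verit) mem_Collect_eq span_Un subsetD)
  have x: "x \<in> V a"
    using xy(1) span_mono[of "E a - {v}" "E a"] assms(3)[OF a(1)] by auto
  have "v \<in> V a"
    using a assms(3) span_base by blast
  moreover have "subspace (V a)"
    using assms(1) a by (auto simp: direct_sum_def)
  ultimately have "y \<in> V a"
    using x xy(3) subspace_diff[of "V a" v x] by simp
  moreover have "y \<in> span (\<Union>b\<in>A - {a}. V b)"
    using xy(2) assms(3) span_superset
    by (intro subsetD[OF span_mono xy(2)]) fastforce
  ultimately have "y = 0"
    using assms(1) a by (auto simp: direct_sum_def)
  then show False
    using xy assms(2)[OF a(1)] a(2) by (auto simp: dependent_def)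
qed

text \<open>A common element would lie in two different summands and so be 0, which an independent
  set cannot contain.\<close>

lemma direct_sum_bases_disjoint:
  assumes "direct_sum scale A V W"
    and "\<And>a. a \<in> A \<Longrightarrow> independent (E a)" "\<And>a. a \<in> A \<Longrightarrow> span (E a) = V a"
    and "a \<in> A" "b \<in> A" "a \<noteq> b"
  shows "E a \<inter> E b = {}"
proof (rule ccontr)
  assume "E a \<inter> E b \<noteq> {}"
  then obtain v where v: "v \<in> E a" "v \<in> E b" by blast
  then have "v \<in> V a" "v \<in> V b"
    using assms(3-5) span_base by blast+
  then have "v \<in> V a \<inter> span (\<Union>b\<in>A - {a}. V b)"
    using assms(5,6) by (auto intro!: span_base)
  then have "v = 0"
    using assms(1,4) by (auto simp: direct_sum_def)
  then show False
    using v(1) assms(2,4) dependent_zero by blast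
qed

section \<open>Weights, and the isoperimetric inequality for direct sums\<close>

lemma weight_eq_card_representation: "weight scale B x = card {b. representation B x b \<noteq> 0}"
  unfolding weight_def by (rule arg_cong[where f = card]) (auto dest: representation_ne_zero)

lemma weight_zero [simp]: "weight scale B 0 = 0"
  by (simp add: weight_eq_card_representation representation_zero)

lemma weight_diff_le:
  assumes "independent B" "x \<in> span B" "y \<in> span B"
  shows "weight scale B (x - y) \<le> weight scale B x + weight scale B y"
proof -
  let ?S = "\<lambda>x. {b. representation B x b \<noteq> 0}"
  have "card (?S (x - y)) \<le> card (?S x \<union> ?S y)"
    by (intro card_mono) (auto simp: finite_representation representation_diff[OF assms(1,3,2)])
  also have "\<dots> \<le> card (?S x) + card (?S y)"
    by (rule card_Un_le)
  finally show ?thesis by (simp add: weight_eq_card_representation)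
qed

lemma weight_sum_le:
  assumes "independent B" "\<And>a. a \<in> F \<Longrightarrow> x a \<in> span B"
  shows "weight scale B (\<Sum>a\<in>F. x a) \<le> (\<Sum>a\<in>F. weight scale B (x a))"
proof (cases "finite F")
  case True
  let ?S = "\<lambda>x. {b. representation B x b \<noteq> 0}"
  have "card (?S (\<Sum>a\<in>F. x a)) \<le> card (\<Union>a\<in>F. ?S (x a))"
    using True assms
    by (intro card_mono) (auto simp: finite_representation representation_sum dest: sum.not_neutral_contains_not_neutral)
  also have "\<dots> \<le> (\<Sum>a\<in>F. card (?S (x a)))"
    by (rule card_UN_le[OF True])
  finally show ?thesis by (simp add: weight_eq_card_representation)
qed simp

text \<open>Coordinates do not change when the basis is enlarged, and vectors over disjoint bases
  cannot cancel, so the support of the sum is the disjoint union of the supports.\<close>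

lemma weight_sum_disjoint_bases:
  assumes "independent U" "finite F" "\<And>a. a \<in> F \<Longrightarrow> E a \<subseteq> U"
    and disj: "\<And>a b. a \<in> F \<Longrightarrow> b \<in> F \<Longrightarrow> a \<noteq> b \<Longrightarrow> E a \<inter> E b = {}"
    and x: "\<And>a. a \<in> F \<Longrightarrow> x a \<in> span (E a)"
  shows "weight scale U (\<Sum>a\<in>F. x a) = (\<Sum>a\<in>F. weight scale (E a) (x a))"
proof -
  let ?S = "\<lambda>a. {v. representation (E a) (x a) v \<noteq> 0}"
  have S: "?S a \<subseteq> E a" for a
    by (auto dest: representation_ne_zero)
  have eq: "representation U (\<Sum>a\<in>F. x a) v = (\<Sum>a\<in>F. representation (E a) (x a) v)" for v
  proof -
    have "x a \<in> span U" if "a \<in> F" for a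
      using span_mono[OF assms(3)[OF that]] x[OF that] by auto
    then have "representation U (\<Sum>a\<in>F. x a) v = (\<Sum>a\<in>F. representation U (x a) v)"
      by (simp add: representation_sum[OF assms(1)])
    also have "\<dots> = (\<Sum>a\<in>F. representation (E a) (x a) v)"
      using representation_extend[OF assms(1) x assms(3)] by (intro sum.cong) auto
    finally show ?thesis .
  qed
  have "{v. representation U (\<Sum>a\<in>F. x a) v \<noteq> 0} = (\<Union>a\<in>F. ?S a)"
  proof (intro equalityI subsetI)
    fix v assume "v \<in> {v. representation U (\<Sum>a\<in>F. x a) v \<noteq> 0}"
    then show "v \<in> (\<Union>a\<in>F. ?S a)"
      unfolding eq by (auto dest: sum.not_neutral_contains_not_neutral)
  next
    fix v assume "v \<in> (\<Union>a\<in>F. ?S a)"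
    then obtain a where a: "a \<in> F" "v \<in> ?S a" by blast
    \<comment> \<open>Only the summand at \<open>a\<close> has a nonzero coordinate at
      \<open>v\<close>, so nothing cancels it.\<close>
    have "representation (E b) (x b) v = 0" if "b \<in> F - {a}" for b
      using disj[of a b] that a S by blast
    then show "v \<in> {v. representation U (\<Sum>a\<in>F. x a) v \<noteq> 0}"
      using a assms(2) unfolding eq by (simp add: sum.remove[of F a])
  qed
  moreover have "card (\<Union>a\<in>F. ?S a) = (\<Sum>a\<in>F. card (?S a))"
  proof (rule card_UN_disjoint[OF assms(2)])
    show "\<forall>a\<in>F. \<forall>b\<in>F. a \<noteq> b \<longrightarrow> ?S a \<inter> ?S b = {}"
      using disj S by blast
  qed (simp add: finite_representation)
  ultimately show ?thesis by (simp add: weight_eq_card_representation)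
qed

text \<open>The components of \<open>x\<close> are replaced one by one. Summing up is harmless: the
  weight on the \<open>f\<close> side is additive, since the values live on disjoint bases, and on
  the \<open>g\<close> side, where the values may overlap in \<open>B\<close>, subadditivity is the
  direction required.\<close>

lemma isoperimetric_direct_sum:
  assumes f: "linear_on scale V X f" and g: "linear_on scale V Y g"
    and V: "subspace V" "direct_sum scale A W V"
    and indep: "independent (\<Union>a\<in>A. E a)" "independent B" "span B = Y"
    and disj: "\<And>a b. a \<in> A \<Longrightarrow> b \<in> A \<Longrightarrow> a \<noteq> b \<Longrightarrow> E a \<inter> E b = {}"
    and fW: "\<And>a x. a \<in> A \<Longrightarrow> x \<in> W a \<Longrightarrow> f x \<in> span (E a)"
    and iso: "\<And>a. a \<in> A \<Longrightarrow> isoperimetric scale (W a) (E a) f B g \<alpha>"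
    and \<alpha>: "0 \<le> \<alpha>"
  shows "isoperimetric scale V (\<Union>a\<in>A. E a) f B g \<alpha>"
  unfolding isoperimetric_def
proof
  let ?U = "\<Union>a\<in>A. E a"
  fix x assume "x \<in> V"
  then have "x \<in> span (\<Union>a\<in>A. W a)"
    using V(2) by (simp add: direct_sum_def)
  moreover have "\<And>a. a \<in> A \<Longrightarrow> subspace (W a)"
    using V(2) by (simp add: direct_sum_def)
  ultimately obtain F z where F: "finite F" "F \<subseteq> A" "\<forall>a\<in>F. z a \<in> W a" "x = (\<Sum>a\<in>F. z a)"
    using span_UN_finite_sum by metis
  have "\<forall>a\<in>F. \<exists>y. y \<in> W a \<and> f (z a) = f y
    \<and> \<alpha> * real (weight scale B (g y)) \<le> real (weight scale (E a) (f y))"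
    using iso F by (fastforce simp: isoperimetric_def)
  then obtain y where y: "\<And>a. a \<in> F \<Longrightarrow> y a \<in> W a" "\<And>a. a \<in> F \<Longrightarrow> f (z a) = f (y a)"
    "\<And>a. a \<in> F \<Longrightarrow> \<alpha> * real (weight scale B (g (y a))) \<le> real (weight scale (E a) (f (y a)))"
    by metis
  have WV: "\<And>a. a \<in> F \<Longrightarrow> W a \<subseteq> V"
    using direct_sum_subset[OF V(2)] F(2) by blast
  have yV: "\<And>a. a \<in> F \<Longrightarrow> y a \<in> V" and zV: "\<And>a. a \<in> F \<Longrightarrow> z a \<in> V"
    using WV y(1) F(3) by blast+
  let ?y = "\<Sum>a\<in>F. y a"
  have fy: "f ?y = (\<Sum>a\<in>F. f (y a))"
    by (rule linear_on_sum[OF f V(1) yV])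
  have "f x = (\<Sum>a\<in>F. f (z a))"
    unfolding F(4) by (rule linear_on_sum[OF f V(1) zV])
  then have "f x = f ?y"
    by (simp add: fy y(2))
  moreover have "?y \<in> V"
    by (rule subspace_sum[OF V(1) yV])
  moreover have "\<alpha> * real (weight scale B (g ?y)) \<le> real (weight scale ?U (f ?y))"
  proof -
    have "weight scale B (g ?y) \<le> (\<Sum>a\<in>F. weight scale B (g (y a)))"
      using indep linear_on_mem[OF g yV] weight_sum_le[of B F "\<lambda>a. g (y a)"]
        linear_on_sum[OF g V(1) yV, of F] by simp
    then have "\<alpha> * real (weight scale B (g ?y)) \<le> \<alpha> * real (\<Sum>a\<in>F. weight scale B (g (y a)))"
      using \<alpha> by (intro mult_left_mono) (simp_all del: of_nat_sum)
    also have "\<dots> = (\<Sum>a\<in>F. \<alpha> * real (weight scale B (g (y a))))"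
      by (simp add: sum_distrib_left)
    also have "\<dots> \<le> (\<Sum>a\<in>F. real (weight scale (E a) (f (y a))))"
      by (intro sum_mono y(3))
    also have "\<dots> = real (weight scale ?U (f ?y))"
    proof -
      have "weight scale ?U (\<Sum>a\<in>F. f (y a)) = (\<Sum>a\<in>F. weight scale (E a) (f (y a)))"
        using F disj fW y(1) by (intro weight_sum_disjoint_bases[OF indep(1)]) blast+
      then show ?thesis by (simp add: fy)
    qed
    finally show ?thesis .
  qed
  ultimately show "\<exists>y\<in>V. f x = f y
    \<and> \<alpha> * real (weight scale B (g y)) \<le> real (weight scale ?U (f y))"
    by blast
qed

end

section \<open>Height-2 cones whose levels 2 and 0 have no homology in degree 1\<close>

locale regular_height2_cone = bit_space scale
  for scale :: "bit \<Rightarrow> 'v::ab_group_add \<Rightarrow> 'v" +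
  fixes C :: "nat \<Rightarrow> 'v set" and d :: "nat \<Rightarrow> 'v \<Rightarrow> 'v"
    and L :: "nat \<Rightarrow> nat \<Rightarrow> 'v set" and D g :: "nat \<Rightarrow> nat \<Rightarrow> 'v \<Rightarrow> 'v"
    and p :: "nat \<Rightarrow> 'v \<Rightarrow> 'v"
  assumes cone: "height2_cone scale C d L D g p"
    and regular: "regular_cone L D"
begin

lemma complex: "three_term_complex scale C d"
  and levels: "direct_sum scale {0, 1, 2} (\<lambda>s. L s i) (C i)"
  and linear_D: "s \<in> {0, 1, 2} \<Longrightarrow> linear_on scale (L s i) (L s (i - 1)) (D s i)"
  and linear_g2: "linear_on scale (L 2 i) (L 1 (i - 1)) (g 2 i)"
  and linear_g1: "linear_on scale (L 1 i) (L 0 (i - 1)) (g 1 i)"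
  and linear_p: "linear_on scale (L 2 i) (L 0 (i - 1)) (p i)"
  and d_level2: "x \<in> L 2 i \<Longrightarrow> d i x = D 2 i x + g 2 i x + p i x"
  and d_level1: "x \<in> L 1 i \<Longrightarrow> d i x = D 1 i x + g 1 i x"
  and d_level0: "x \<in> L 0 i \<Longrightarrow> d i x = D 0 i x"
proof -
  note unfolded = cone[unfolded height2_cone_def]
  show "three_term_complex scale C d" "direct_sum scale {0, 1, 2} (\<lambda>s. L s i) (C i)"
    "linear_on scale (L 2 i) (L 0 (i - 1)) (p i)"
    using unfolded by blast+
  show "s \<in> {0, 1, 2} \<Longrightarrow> linear_on scale (L s i) (L s (i - 1)) (D s i)"
    using unfolded by blast
  have "linear_on scale (L s i) (L (s - 1) (i - 1)) (g s i)" if "s \<in> {1, 2}" for s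
    using unfolded that by blast
  from this[of 2] this[of 1] show "linear_on scale (L 2 i) (L 1 (i - 1)) (g 2 i)"
    "linear_on scale (L 1 i) (L 0 (i - 1)) (g 1 i)"
    by simp_all
  show "x \<in> L 2 i \<Longrightarrow> d i x = D 2 i x + g 2 i x + p i x"
    "x \<in> L 1 i \<Longrightarrow> d i x = D 1 i x + g 1 i x" "x \<in> L 0 i \<Longrightarrow> d i x = D 0 i x"
    using unfolded by blast+
qed

text \<open>Keeps degree 1 in the form \<open>1\<close>: the \<open>Suc 0\<close> produced by
  unfolding \<open>boundaries\<close> in degree 0 is rewritten back.\<close>

declare One_nat_def [simp del] One_nat_def [symmetric, simp]

lemmas linear_D2 = linear_D[of 2, simplified]
  and linear_D1 = linear_D[of 1, simplified]
  and linear_D0 = linear_D[of 0, simplified]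

lemma subspace_C: "subspace (C i)"
  and linear_d: "linear_on scale (C i) (C (i - 1)) (d i)"
  and d_d: "x \<in> C i \<Longrightarrow> d (i - 1) (d i x) = 0"
  and C_trivial: "i > 2 \<Longrightarrow> C i = {0}"
  using complex unfolding three_term_complex_def by blast+

lemma subspace_L: "s \<in> {0, 1, 2} \<Longrightarrow> subspace (L s i)"
  using levels[of i] unfolding direct_sum_def by blast

lemma L_subset_C: "s \<in> {0, 1, 2} \<Longrightarrow> L s i \<subseteq> C i"
  using direct_sum_subset[OF levels] .

lemma subspace_boundaries_C: "subspace (boundaries C d i)"
  unfolding boundaries_def by (rule linear_on_image_subspace[OF linear_d subspace_C])

lemma subspace_boundaries_L: "s \<in> {0, 1, 2} \<Longrightarrow> subspace (boundaries (L s) (D s) i)"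
  unfolding boundaries_def by (rule linear_on_image_subspace[OF linear_D subspace_L])

lemma C_decompose:
  assumes "x \<in> C i"
  obtains a b c where "a \<in> L 2 i" "b \<in> L 1 i" "c \<in> L 0 i" "x = a + b + c"
proof -
  have "span (L 2 i \<union> L 1 i \<union> L 0 i) = C i"
    using levels[of i] by (simp add: direct_sum_def ac_simps)
  then have "x \<in> span (L 2 i \<union> L 1 i \<union> L 0 i)"
    using assms by simp
  moreover have "span (L 2 i) = L 2 i" "span (L 1 i) = L 1 i" "span (L 0 i) = L 0 i"
    using subspace_L by (simp_all add: span_eq_iff)
  ultimately show thesis
    using that unfolding span_Un by auto
qed

lemma levels_sum_eq_0:
  assumes "a \<in> L 2 i" "b \<in> L 1 i" "c \<in> L 0 i" "a + b + c = 0"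
  shows "a = 0" "b = 0" "c = 0"
proof -
  define x where "x s = (if s = 2 then a else if s = 1 then b else c)" for s :: nat
  have zero: "x s = 0" if "s \<in> {0, 1, 2}" for s
  proof (rule direct_sum_zero_component[OF levels _ _ _ that])
    show "(\<Sum>s\<in>{0, 1, 2}. x s) = 0"
      using assms(4) by (simp add: x_def ac_simps)
  qed (use assms(1-3) in \<open>auto simp: x_def\<close>)
  show "a = 0" "b = 0" "c = 0"
    using zero[of 2] zero[of 1] zero[of 0] by (simp_all add: x_def)
qed

lemma d_decompose:
  assumes "a \<in> L 2 i" "b \<in> L 1 i" "c \<in> L 0 i"
  shows "d i (a + b + c) = D 2 i a + (g 2 i a + D 1 i b) + (p i a + g 1 i b + D 0 i c)"
proof -
  have C: "a \<in> C i" "b \<in> C i" "c \<in> C i"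
    using assms L_subset_C by auto
  then show ?thesis
    using linear_on_add[OF linear_d] subspace_add[OF subspace_C] assms
    by (simp add: d_level2 d_level1 d_level0 ac_simps)
qed

text \<open>These are the rows of the triangular matrix applied to the components. They lie in
  different levels, so they vanish separately.\<close>

lemma d_eq_0_components:
  assumes "a \<in> L 2 i" "b \<in> L 1 i" "c \<in> L 0 i" "d i (a + b + c) = 0"
  shows "D 2 i a = 0" "g 2 i a + D 1 i b = 0" "p i a + g 1 i b + D 0 i c = 0"
proof -
  have "D 2 i a \<in> L 2 (i - 1)" "g 2 i a + D 1 i b \<in> L 1 (i - 1)"
    "p i a + g 1 i b + D 0 i c \<in> L 0 (i - 1)"
    using assms(1-3) linear_on_mem[OF linear_D2] linear_on_mem[OF linear_D1] linear_on_mem[OF linear_D0]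
      linear_on_mem[OF linear_g2] linear_on_mem[OF linear_g1] linear_on_mem[OF linear_p]
    by (auto intro!: subspace_add subspace_L)
  from levels_sum_eq_0[OF this] show "D 2 i a = 0" "g 2 i a + D 1 i b = 0"
    "p i a + g 1 i b + D 0 i c = 0"
    using assms d_decompose by auto
qed

text \<open>The level-0 row of \<open>d (d y) = 0\<close>. It makes \<open>g 1\<close> a chain map
  up to sign, hence well defined on homology classes.\<close>

lemma g1_D1:
  assumes y: "y \<in> L 1 i"
  shows "g 1 (i - 1) (D 1 i y) + D 0 (i - 1) (g 1 i y) = 0"
proof -
  have zero: "0 \<in> L 2 (i - 1)" "p (i - 1) 0 = 0"
    using subspace_0[OF subspace_L] linear_on_zero[OF linear_p subspace_L] by auto
  \<comment> \<open>The zero is the missing level-2 component of \<open>d i y\<close>.\<close>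
  have "d (i - 1) (0 + D 1 i y + g 1 i y) = 0"
    using y L_subset_C[of 1 i] d_d[of y i] by (auto simp: d_level1)
  from d_eq_0_components(3)[OF zero(1) linear_on_mem[OF linear_D1 y] linear_on_mem[OF linear_g1 y] this]
  show ?thesis
    by (simp add: zero(2))
qed

section \<open>Homology of the levels and of the embedded complex\<close>

lemma boundaries_0: "boundaries V f 0 = f 1 ` V 1"
  and boundaries_1: "boundaries V f 1 = f 2 ` V 2"
  by (simp_all add: boundaries_def)

text \<open>Everything vanishes in degree 3. The degree-2 classes of level 2 are therefore
  singletons.\<close>

lemma boundaries_level2: "boundaries (L 2) (D 2) 2 = {0}"
proof -
  have "L 2 3 = {0}"
    using L_subset_C[of 2 3] C_trivial[of 3] subspace_0[OF subspace_L[of 2 3]] by auto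
  then show ?thesis
    using linear_on_zero[OF linear_D2 subspace_L, of 3] by (simp add: boundaries_def)
qed

text \<open>Regularity as used later: in level 2 it provides a preimage of the top component of a
  cycle, in level 0 it disposes of the remaining cycle.\<close>

lemma regular_cycle_boundary:
  assumes "s \<in> {0, 2}" "x \<in> L s 1" "D s 1 x = 0"
  shows "\<exists>y\<in>L s 2. x = D s 2 y"
proof -
  have "homology (L s) (D s) 1 = {boundaries (L s) (D s) 1}"
    using assms(1) regular by (auto simp: regular_cone_def)
  then have "x +o boundaries (L s) (D s) 1 = boundaries (L s) (D s) 1"
    using assms(2,3) by (auto simp: homology_def quot_def cycles_def)
  moreover have "subspace (boundaries (L s) (D s) 1)"
    using assms(1) by (intro subspace_boundaries_L) auto
  ultimately show ?thesis
    by (auto simp: coset_eq_iff boundaries_1)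
qed

text \<open>As \<open>induced\<close> takes the image of a whole coset, every representative
  \<open>x + D 1 2 y\<close> must be sent to a boundary; \<open>g1_D1\<close> reduces this to the
  case of \<open>x\<close>.\<close>

lemma embedded_cyclesI:
  assumes x: "x \<in> cycles (L 1) (D 1) 1" and w: "w \<in> L 0 1" "g 1 1 x = D 0 1 w"
  shows "hclass (L 1) (D 1) 1 x \<in> embedded_cycles L D g"
proof -
  let ?B0 = "boundaries (L 0) (D 0) 0" and ?B1 = "boundaries (L 1) (D 1) 1"
  have B0: "subspace ?B0"
    by (rule subspace_boundaries_L) simp
  have xL: "x \<in> L 1 1"
    using x by (simp add: cycles_def)
  have g_mem: "g 1 1 (x + D 1 2 y) \<in> ?B0" if y: "y \<in> L 1 2" for y
  proof -
    have Dy: "D 1 2 y \<in> L 1 1" and gy: "g 1 2 y \<in> L 0 1"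
      using linear_on_mem[OF linear_D1 y] linear_on_mem[OF linear_g1 y] by simp_all
    have "g 1 1 (D 1 2 y) = - D 0 1 (g 1 2 y)"
      using g1_D1[OF y] by (simp add: eq_neg_iff_add_eq_0)
    then have "g 1 1 (x + D 1 2 y) = D 0 1 w - D 0 1 (g 1 2 y)"
      using linear_on_add[OF linear_g1 xL Dy] w by simp
    then show ?thesis
      using w(1) gy subspace_diff[OF B0] by (simp add: boundaries_0)
  qed
  have "g 1 1 ` (x +o ?B1) + ?B0 = ?B0"
  proof
    show "g 1 1 ` (x +o ?B1) + ?B0 \<subseteq> ?B0"
      using g_mem subspace_add[OF B0] by (auto simp: set_plus_def elt_set_plus_def boundaries_1)
    \<comment> \<open>For this inclusion the single representative \<open>x\<close> suffices,
      because \<open>?B0\<close> is a subspace.\<close>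
    show "?B0 \<subseteq> g 1 1 ` (x +o ?B1) + ?B0"
    proof
      fix u assume u: "u \<in> ?B0"
      have "g 1 1 x \<in> ?B0"
        using w by (simp add: boundaries_0)
      then have "u - g 1 1 x \<in> ?B0"
        using u subspace_diff[OF B0] by blast
      moreover have "g 1 1 x \<in> g 1 1 ` (x +o ?B1)"
        using set_plus_intro2[OF subspace_0[OF subspace_boundaries_L], of 1 x] by force
      ultimately show "u \<in> g 1 1 ` (x +o ?B1) + ?B0"
        using set_plus_intro[of "g 1 1 x" _ "u - g 1 1 x"] by simp
    qed
  qed
  then show ?thesis
    using x by (simp add: embedded_cycles_def induced_def hclass_def homology_def quot_def)
qed

text \<open>Reduces nontriviality of a coset of cosets to a statement about vectors: were the class
  of \<open>x\<close> trivial, comparing elements of the cosets would exhibit \<open>x\<close> in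
  the excluded form.\<close>

lemma embedded_essentialI:
  assumes x: "x \<in> cycles (L 1) (D 1) 1" and w: "w \<in> L 0 1" "g 1 1 x = D 0 1 w"
    and nontrivial: "\<And>z y. z \<in> L 2 2 \<Longrightarrow> D 2 2 z = 0 \<Longrightarrow> y \<in> L 1 2 \<Longrightarrow> x \<noteq> g 2 2 z + D 1 2 y"
  shows "x \<in> embedded_essential L D g"
proof -
  let ?B1 = "boundaries (L 1) (D 1) 1" and ?EB = "embedded_boundaries L D g"
  \<comment> \<open>The class of \<open>z\<close> in level 2 is the singleton of \<open>z\<close>,
    so its image is the coset of \<open>g 2 2 z\<close>.\<close>
  have EB: "?EB = (\<lambda>z. {g 2 2 z} + ?B1) ` cycles (L 2) (D 2) 2"
    unfolding embedded_boundaries_def homology_def quot_def induced_def boundaries_level2 image_image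
    by (simp add: elt_set_plus_def)
  have "0 \<in> cycles (L 2) (D 2) 2"
    using subspace_0[OF subspace_L] linear_on_zero[OF linear_D2 subspace_L] by (simp add: cycles_def)
  then have "{g 2 2 0} + ?B1 \<in> ?EB"
    unfolding EB by blast
  \<comment> \<open>The zero class of level 1, obtained from \<open>z = 0\<close>.\<close>
  then have B1: "?B1 \<in> ?EB"
    using linear_on_zero[OF linear_g2 subspace_L] by (simp add: set_zero)
  have "hclass (L 1) (D 1) 1 x +o ?EB \<noteq> ?EB"
  proof
    assume "hclass (L 1) (D 1) 1 x +o ?EB = ?EB"
    then have "hclass (L 1) (D 1) 1 x + ?B1 \<in> ?EB"
      using B1 set_plus_intro2 by blast
    then obtain z where z: "z \<in> cycles (L 2) (D 2) 2" "(x +o ?B1) + ?B1 = {g 2 2 z} + ?B1"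
      unfolding EB hclass_def by blast
    have "0 \<in> ?B1"
      by (rule subspace_0[OF subspace_boundaries_L]) simp
    \<comment> \<open>The element \<open>x\<close> of the left coset is read off again in the right
      one.\<close>
    then have "x + 0 + 0 \<in> (x +o ?B1) + ?B1"
      by blast
    then obtain y where "y \<in> L 1 2" "x = g 2 2 z + D 1 2 y"
      unfolding z(2) by (auto simp: set_plus_def boundaries_1)
    then show False
      using nontrivial[of z y] z(1) by (auto simp: cycles_def)
  qed
  then show ?thesis
    using x embedded_cyclesI[OF x w]
    by (simp add: embedded_essential_def embedded_homology_def quot_def)
qed

text \<open>The homological half of the argument, free of weights: it holds for any preimage
  \<open>y\<close> of \<open>a\<close>, which leaves the choice of \<open>y\<close> to the
  isoperimetric inequality.\<close>

lemma embedded_essential_of_essential: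
  assumes ess: "a + b + c \<in> essential_cycles C d 1"
    and a: "a \<in> L 2 1" and b: "b \<in> L 1 1" and c: "c \<in> L 0 1"
    and y: "y \<in> L 2 2" "a = D 2 2 y"
  shows "b - g 2 2 y \<in> embedded_essential L D g"
proof -
  have cyc: "a + b + c \<in> C 1" "d 1 (a + b + c) = 0" and nb: "a + b + c \<notin> d 2 ` C 2"
    using ess coset_eq_iff[OF subspace_boundaries_C, of "a + b + c" 1]
    by (simp_all add: essential_cycles_def cycles_def hclass_def flip: boundaries_1)
  have LC: "L 2 i \<subseteq> C i" "L 1 i \<subseteq> C i" "L 0 i \<subseteq> C i" for i
    using L_subset_C by auto
  have gy: "g 2 2 y \<in> L 1 1" and py: "p 2 y \<in> L 0 1"
    using linear_on_mem[OF linear_g2 y(1)] linear_on_mem[OF linear_p y(1)] by simp_all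
  define b' where "b' = b - g 2 2 y"
  define c' where "c' = c - p 2 y"
  have b': "b' \<in> L 1 1" and c': "c' \<in> L 0 1"
    unfolding b'_def c'_def using b gy c py by (auto intro!: subspace_diff subspace_L)
  have zero: "0 \<in> L 2 1" "g 2 1 0 = 0" "p 1 0 = 0"
    using subspace_0[OF subspace_L] linear_on_zero[OF linear_g2 subspace_L]
      linear_on_zero[OF linear_p subspace_L] by auto
  have l: "a + b + c = d 2 y + (0 + b' + c')"
    using y by (simp add: b'_def c'_def d_level2)
  have C: "y \<in> C 2" "0 + b' + c' \<in> C 1" "d 2 y \<in> C 1"
    using y(1) b' c' subsetD[OF LC(1)] subsetD[OF LC(2)] subsetD[OF LC(3)]
      linear_on_mem[OF linear_d, of y 2] by (auto intro!: subspace_add subspace_C)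
  have "d 1 (0 + b' + c') = 0"
    using cyc(2) d_d[OF C(1)] linear_on_add[OF linear_d C(3,2)] unfolding l by simp
  \<comment> \<open>With the level-2 component gone, the level-1 row makes \<open>b'\<close> a
    cycle, and the level-0 row makes its image under \<open>g 1 1\<close> a boundary.\<close>
  from d_eq_0_components(2,3)[OF zero(1) b' c' this]
  have Db': "D 1 1 b' = 0" and gb': "g 1 1 b' + D 0 1 c' = 0"
    by (simp_all add: zero)
  have "- c' \<in> L 0 1" and "g 1 1 b' = D 0 1 (- c')"
  proof -
    show "- c' \<in> L 0 1"
      using c' by (simp add: subspace_neg subspace_L)
    have "D 0 1 (- c') = - D 0 1 c'"
      using linear_on_diff[OF linear_D0 subspace_L subspace_0[OF subspace_L] c']
        linear_on_zero[OF linear_D0 subspace_L] by simp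
    then show "g 1 1 b' = D 0 1 (- c')"
      using gb' by (metis eq_neg_iff_add_eq_0)
  qed
  moreover have "b' \<noteq> g 2 2 z + D 1 2 u" if z: "z \<in> L 2 2" "D 2 2 z = 0" and u: "u \<in> L 1 2" for z u
  proof
    assume eq: "b' = g 2 2 z + D 1 2 u"
    have zero2: "0 \<in> L 0 2" "D 0 2 0 = 0"
      using subspace_0[OF subspace_L] linear_on_zero[OF linear_D0 subspace_L] by auto
    \<comment> \<open>What is left in level 0 after the boundary of \<open>z + u\<close> has
      cancelled \<open>b'\<close>; level 2 stays empty because \<open>D 2 2 z = 0\<close>.\<close>
    define c'' where "c'' = c' - p 2 z - g 1 2 u"
    have c'': "c'' \<in> L 0 1"
      unfolding c''_def using c' linear_on_mem[OF linear_p z(1)] linear_on_mem[OF linear_g1 u]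
      by (auto intro!: subspace_diff subspace_L)
    have dzu: "d 2 (z + u + 0) = b' + (c' - c'')"
      unfolding d_decompose[OF z(1) u zero2(1)] by (simp add: z eq zero2 c''_def)
    have zu: "z + u + 0 \<in> C 2"
      using z u LC subspace_0[OF subspace_C] by (blast intro: subspace_add[OF subspace_C])
    have "c'' \<in> C 1"
      using c'' LC by blast
    have bcc: "b' + c' = d 2 (z + u + 0) + c''"
      unfolding dzu by simp
    have "d 1 (b' + c') = 0"
      using \<open>d 1 (0 + b' + c') = 0\<close> by simp
    then have "d 1 c'' = 0"
      using linear_on_add[OF linear_d _ \<open>c'' \<in> C 1\<close>, of "d 2 (z + u + 0)"]
        linear_on_mem[OF linear_d zu] d_d[OF zu] unfolding bcc by simp
    then obtain w where w: "w \<in> L 0 2" "c'' = D 0 2 w"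
      using regular_cycle_boundary[of 0 c''] c'' by (auto simp: d_level0)
    have wC: "w \<in> C 2"
      using w LC by blast
    \<comment> \<open>All three pieces are boundaries, contradicting \<open>nb\<close>.\<close>
    have "a + b + c = d 2 y + (d 2 (z + u + 0) + d 2 w)"
      unfolding l using bcc w by (simp add: d_level0)
    also have "\<dots> = d 2 (y + (z + u + 0 + w))"
      using C(1) zu wC subspace_add[OF subspace_C zu wC] linear_on_add[OF linear_d] by simp
    finally show False
      using nb C(1) subspace_add[OF subspace_C C(1) subspace_add[OF subspace_C zu wC]] by blast
  qed
  ultimately have "b' \<in> embedded_essential L D g"
    using b' Db' by (intro embedded_essentialI[where w = "- c'"]) (auto simp: cycles_def)
  then show ?thesis
    by (simp add: b'_def)
qed

section \<open>Comparison of the minimum weights\<close>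

lemma isoperimetric_min_weight:
  assumes B: "\<And>s. s \<in> {0, 1, 2} \<Longrightarrow> finite_basis scale (L s 1) (B s)"
    and \<alpha>: "0 < \<alpha>" "\<alpha> \<le> 1"
    and iso: "isoperimetric scale (L 2 2) (B 2) (D 2 2) (B 1) (g 2 2) \<alpha>"
  shows "ereal \<alpha> * min_weight scale (B 1) (embedded_essential L D g)
    \<le> min_weight scale (\<Union>s\<in>{0, 1, 2}. B s) (essential_cycles C d 1)"
  unfolding min_weight_def[of _ "\<Union>s\<in>{0, 1, 2}. B s"]
\<comment> \<open>Each essential cycle yields an embedded one. This also settles the case of an
  infinite embedded minimum: there are then no essential cycles.\<close>
proof (rule INF_greatest)
  fix l assume l: "l \<in> essential_cycles C d 1"
  let ?U = "\<Union>s\<in>{0, 1, 2}. B s"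
  have indep: "\<And>s. s \<in> {0, 1, 2} \<Longrightarrow> independent (B s)"
    and span: "\<And>s. s \<in> {0, 1, 2} \<Longrightarrow> span (B s) = L s 1"
    using B by (auto simp: finite_basis_def)
  have "l \<in> C 1" "d 1 l = 0"
    using l by (auto simp: essential_cycles_def cycles_def)
  then obtain a b c where abc: "a \<in> L 2 1" "b \<in> L 1 1" "c \<in> L 0 1" "l = a + b + c"
    using C_decompose by metis
  have "D 2 1 a = 0"
    using d_eq_0_components(1) abc \<open>d 1 l = 0\<close> by blast
  then obtain y where "y \<in> L 2 2" "a = D 2 2 y"
    using regular_cycle_boundary[of 2 a] abc(1) by auto
  \<comment> \<open>The first preimage of \<open>a\<close> is exchanged for one with the same image
    under \<open>D 2 2\<close> that satisfies the inequality.\<close>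
  then obtain y where y: "y \<in> L 2 2" "a = D 2 2 y"
    and y_iso: "\<alpha> * real (weight scale (B 1) (g 2 2 y)) \<le> real (weight scale (B 2) a)"
    using iso unfolding isoperimetric_def by metis
  have ess: "b - g 2 2 y \<in> embedded_essential L D g"
    using embedded_essential_of_essential l abc y by blast
  have gy: "g 2 2 y \<in> L 1 1"
    using linear_on_mem[OF linear_g2 y(1)] by simp
  define x where "x s = (if s = 2 then a else if s = 1 then b else c)" for s :: nat
  have "weight scale ?U (\<Sum>s\<in>{0, 1, 2}. x s) = (\<Sum>s\<in>{0, 1, 2}. weight scale (B s) (x s))"
  proof (rule weight_sum_disjoint_bases)
    show "independent ?U"
      by (rule direct_sum_bases_independent[OF levels indep span])
    show "B s \<inter> B t = {}" if "s \<in> {0, 1, 2}" "t \<in> {0, 1, 2}" "s \<noteq> t" for s t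
      by (rule direct_sum_bases_disjoint[OF levels indep span that])
    show "x s \<in> span (B s)" if "s \<in> {0, 1, 2}" for s
      using span[OF that] that abc by (auto simp: x_def)
  qed auto
  then have weight_l: "weight scale ?U l
      = weight scale (B 0) c + weight scale (B 1) b + weight scale (B 2) a"
    by (simp add: x_def abc(4) ac_simps)
  have "real (weight scale (B 1) (b - g 2 2 y))
      \<le> real (weight scale (B 1) b) + real (weight scale (B 1) (g 2 2 y))"
    using weight_diff_le[of "B 1" b "g 2 2 y"] indep[of 1] span[of 1] abc gy by simp
  then have "\<alpha> * real (weight scale (B 1) (b - g 2 2 y))
      \<le> \<alpha> * (real (weight scale (B 1) b) + real (weight scale (B 1) (g 2 2 y)))"
    using \<alpha> by (intro mult_left_mono) auto
  \<comment> \<open>Here \<open>\<alpha> \<le> 1\<close> bounds the term of \<open>b\<close>, and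
    the choice of \<open>y\<close> the term of \<open>g 2 2 y\<close>.\<close>
  also have "\<dots> \<le> real (weight scale (B 1) b) + real (weight scale (B 2) a)"
    using y_iso mult_right_mono[OF \<alpha>(2), of "real (weight scale (B 1) b)"] by (simp add: distrib_left)
  also have "\<dots> \<le> real (weight scale ?U l)"
    unfolding weight_l by simp
  finally have bound: "\<alpha> * real (weight scale (B 1) (b - g 2 2 y)) \<le> real (weight scale ?U l)" .
  have "ereal \<alpha> * min_weight scale (B 1) (embedded_essential L D g)
      \<le> ereal \<alpha> * ereal (real (weight scale (B 1) (b - g 2 2 y)))"
    unfolding min_weight_def using \<alpha> ess by (intro ereal_mult_left_mono INF_lower) auto
  also have "\<dots> \<le> ereal (real (weight scale ?U l))"
    using bound by simp
  finally show "ereal \<alpha> * min_weight scale (B 1) (embedded_essential L D g)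
      \<le> ereal (real (weight scale ?U l))" .
qed

lemma isoperimetric_level2:
  assumes B: "\<And>s i. s \<in> {0, 1, 2} \<Longrightarrow> finite_basis scale (L s i) (B s i)"
    and sum: "based_direct_sum scale (L 2) (D 2) (B 2) A W E"
    and iso: "\<And>a. a \<in> A \<Longrightarrow> isoperimetric scale (W a 2) (E a 1) (D 2 2) (B 1 1) (g 2 2) \<alpha>"
    and \<alpha>: "0 \<le> \<alpha>"
  shows "isoperimetric scale (L 2 2) (B 2 1) (D 2 2) (B 1 1) (g 2 2) \<alpha>"
proof -
  note sum' = sum[unfolded based_direct_sum_def]
  have W: "\<And>a. a \<in> A \<Longrightarrow> three_term_complex scale (W a) (D 2)"
    "\<And>a i. a \<in> A \<Longrightarrow> finite_basis scale (W a i) (E a i)"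
    "\<And>i. direct_sum scale A (\<lambda>a. W a i) (L 2 i)"
    using sum' by simp_all
  have B21: "B 2 1 = (\<Union>a\<in>A. E a 1)"
    using sum' by simp
  have "isoperimetric scale (L 2 2) (\<Union>a\<in>A. E a 1) (D 2 2) (B 1 1) (g 2 2) \<alpha>"
  proof (rule isoperimetric_direct_sum[OF linear_D2 linear_g2])
    show "direct_sum scale A (\<lambda>a. W a 2) (L 2 2)"
      by (rule W)
    show "independent (\<Union>a\<in>A. E a 1)"
      using B[of 2 1] by (simp add: finite_basis_def flip: B21)
    show "independent (B 1 1)" "span (B 1 1) = L 1 (2 - 1)"
      using B[of 1 1] by (simp_all add: finite_basis_def)
    show "E a 1 \<inter> E b 1 = {}" if "a \<in> A" "b \<in> A" "a \<noteq> b" for a b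
      using sum' that by blast
    show "D 2 2 x \<in> span (E a 1)" if "a \<in> A" "x \<in> W a 2" for a x
    proof -
      \<comment> \<open>Each summand is a complex under the restricted differential, so
        \<open>D 2 2\<close> does not leave it and its values have coordinates in
        \<open>E a 1\<close>.\<close>
      have "linear_on scale (W a 2) (W a (2 - 1)) (D 2 2)"
        using W(1)[OF that(1)] unfolding three_term_complex_def by blast
      moreover have "span (E a 1) = W a 1"
        using W(2)[OF that(1)] by (simp add: finite_basis_def)
      ultimately show ?thesis
        using linear_on_mem[OF _ that(2)] by simp
    qed
  qed (use iso \<alpha> subspace_L in auto)
  then show ?thesis
    by (simp add: B21)
qed

end

theorem lemmaI3:
  fixes scale :: "bit \<Rightarrow> 'v::ab_group_add \<Rightarrow> 'v"
    and C :: "nat \<Rightarrow> 'v set" and d :: "nat \<Rightarrow> 'v \<Rightarrow> 'v"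
    and L :: "nat \<Rightarrow> nat \<Rightarrow> 'v set" and D g :: "nat \<Rightarrow> nat \<Rightarrow> 'v \<Rightarrow> 'v"
    and p :: "nat \<Rightarrow> 'v \<Rightarrow> 'v"
    and B :: "nat \<Rightarrow> nat \<Rightarrow> 'v set"
    and \<alpha> :: real
  assumes "vector_space scale"
    and "height2_cone scale C d L D g p"
    and "regular_cone L D"
    and "\<forall>s\<in>{0, 1, 2}. \<forall>i. finite_basis scale (L s i) (B s i)"
    and "0 < \<alpha>" and "\<alpha> \<le> 1"
  shows "(isoperimetric scale (L 2 2) (B 2 1) (D 2 2) (B 1 1) (g 2 2) \<alpha> \<longrightarrow>
            min_weight scale (\<Union>s\<in>{0, 1, 2}. B s 1) (essential_cycles C d 1)
              \<ge> ereal \<alpha> * min_weight scale (B 1 1) (embedded_essential L D g))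
       \<and> (\<forall>(A :: 'i set) W E.
            based_direct_sum scale (L 2) (D 2) (B 2) A W E
          \<and> (\<forall>a\<in>A. isoperimetric scale (W a 2) (E a 1) (D 2 2) (B 1 1) (g 2 2) \<alpha>) \<longrightarrow>
            min_weight scale (\<Union>s\<in>{0, 1, 2}. B s 1) (essential_cycles C d 1)
              \<ge> ereal \<alpha> * min_weight scale (B 1 1) (embedded_essential L D g))"
proof -
  interpret vector_space scale by fact
  interpret regular_height2_cone scale C d L D g p
    by unfold_locales (use assms(2,3) in auto)
  have B: "\<And>s i. s \<in> {0, 1, 2} \<Longrightarrow> finite_basis scale (L s i) (B s i)"
    using assms(4) by blast
  have min_weight: "ereal \<alpha> * min_weight scale (B 1 1) (embedded_essential L D g)
      \<le> min_weight scale (\<Union>s\<in>{0, 1, 2}. B s 1) (essential_cycles C d 1)"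
    if "isoperimetric scale (L 2 2) (B 2 1) (D 2 2) (B 1 1) (g 2 2) \<alpha>"
    by (rule isoperimetric_min_weight[OF _ assms(5,6) that]) (rule B)
  \<comment> \<open>Reduces the direct-sum claim to the first one.\<close>
  have "isoperimetric scale (L 2 2) (B 2 1) (D 2 2) (B 1 1) (g 2 2) \<alpha>"
    if "based_direct_sum scale (L 2) (D 2) (B 2) A W E"
      and "\<forall>a\<in>A. isoperimetric scale (W a 2) (E a 1) (D 2 2) (B 1 1) (g 2 2) \<alpha>"
    for A :: "'i set" and W E
    using assms(5) that by (intro isoperimetric_level2[OF B, of A W E]) auto
  with min_weight show ?thesis
    by blast
qed

end
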